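(* Let $\bar p=(p(1),p(2),\dots)$, $0\le p(i)\le 1$. If $\prod_{i=1}^\infty(1-p(i))>0$, then for every first order sentence $\psi$ from $L_{\le}$ $$\limsup_{n\to\infty}\mathrm{Prob}(n,\bar p;\psi)-\liminf_{n\to\infty}\mathrm{Prob}(n,\bar p;\psi)<1.$$
   Context: For a sequence $\bar p=(p(1),p(2),\dots)$ with $0\le p(i)\le 1$, $G(n,\bar p)$ is the random graph with vertex set $[n]=\{1,\dots,n\}$ in which each pair of distinct vertices $v,w$ is an edge with probability $p(|v-w|)$, independently for each pair. $L_{\le}$ is first order logic with equality, a binary adjacency predicate and a binary predicate "$x\le y$". $\mathrm{Prob}(n,\bar p;\psi)$ denotes the probability that the sentence $\psi$ holds in the structure with universe $[n]$ whose adjacency relation is given by $G(n,\bar p)$ and whose predicate $\le$ is the usual order on $[n]$. *)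

theory Defs
  imports "HOL-Probability.Probability"
begin

datatype fo_fm =
    FEq nat nat
  | FAdj nat nat
  | FLe nat nat
  | FNot fo_fm
  | FAnd fo_fm fo_fm
  | FEx nat fo_fm

fun free_vars :: "fo_fm \<Rightarrow> nat set" where
  "free_vars (FEq x y) = {x, y}"
| "free_vars (FAdj x y) = {x, y}"
| "free_vars (FLe x y) = {x, y}"
| "free_vars (FNot \<phi>) = free_vars \<phi>"
| "free_vars (FAnd \<phi> \<psi>) = free_vars \<phi> \<union> free_vars \<psi>"
| "free_vars (FEx x \<phi>) = free_vars \<phi> - {x}"

definition sentence :: "fo_fm \<Rightarrow> bool" where
  "sentence \<phi> \<longleftrightarrow> free_vars \<phi> = {}"

text \<open>A graph on \<open>{1..n}\<close> is given by its set \<open>E\<close> of edges, each a two-element set of vertices.\<close>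

fun sat :: "nat \<Rightarrow> nat set set \<Rightarrow> (nat \<Rightarrow> nat) \<Rightarrow> fo_fm \<Rightarrow> bool" where
  "sat n E s (FEq x y) \<longleftrightarrow> s x = s y"
| "sat n E s (FAdj x y) \<longleftrightarrow> {s x, s y} \<in> E"
| "sat n E s (FLe x y) \<longleftrightarrow> s x \<le> s y"
| "sat n E s (FNot \<phi>) \<longleftrightarrow> \<not> sat n E s \<phi>"
| "sat n E s (FAnd \<phi> \<psi>) \<longleftrightarrow> sat n E s \<phi> \<and> sat n E s \<psi>"
| "sat n E s (FEx x \<phi>) \<longleftrightarrow> (\<exists>a\<in>{1..n}. sat n E (s(x := a)) \<phi>)"

definition holds_in :: "nat \<Rightarrow> nat set set \<Rightarrow> fo_fm \<Rightarrow> bool" where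
  "holds_in n E \<phi> \<longleftrightarrow> (\<forall>s. range s \<subseteq> {1..n} \<longrightarrow> sat n E s \<phi>)"

text \<open>The unordered pair of distinct vertices \<open>v\<close>, \<open>w\<close> is indexed by \<open>(v, w)\<close> with \<open>v < w\<close>, so
  the truncated difference \<open>w - v\<close> is the distance of \<open>v\<close> and \<open>w\<close>. The value \<open>p 0\<close> is never used.\<close>

definition random_graph :: "nat \<Rightarrow> (nat \<Rightarrow> real) \<Rightarrow> nat set set pmf" where
  "random_graph n p =
     map_pmf (\<lambda>X. {{v, w} | v w. 1 \<le> v \<and> v < w \<and> w \<le> n \<and> X (v, w)})
       (Pi_pmf {(v, w). 1 \<le> v \<and> v < w \<and> w \<le> n} False
         (\<lambda>(v, w). bernoulli_pmf (p (w - v))))"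

definition Prob :: "nat \<Rightarrow> (nat \<Rightarrow> real) \<Rightarrow> fo_fm \<Rightarrow> real" where
  "Prob n p \<psi> = measure_pmf.prob (random_graph n p) {E. holds_in n E \<psi>}"

end

theory Submission
  imports Defs "HOL-Algebra.Group" "HOL-Library.FSet"
begin

text \<open>
  Let \<open>k\<close> bound the quantifier depth of \<open>\<psi>\<close>. The theorem holds because of a finite ordered graph
  \<open>U\<close> that is absorbing: for every graph \<open>X\<close> which \<open>G(n, p)\<close> can produce, the juxtaposition
  \<open>U + X + U\<close> (vertices of the first summand before those of the second, no edges in between)
  satisfies the same sentences of depth \<open>k\<close> as \<open>U\<close> itself. Given such a \<open>U\<close> with \<open>L\<close> vertices, the
  random graph has the form \<open>U + X + U\<close> with a probability that is bounded below by some \<open>c > 0\<close> not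
  depending on \<open>n \<ge> 2 L\<close>: only the \<open>2 L\<close> outermost vertices are constrained, and the probability
  that one vertex sends no edges in a given direction is at least \<open>\<Prod>(1 - p(i)) > 0\<close>. So the
  probability of \<open>\<psi>\<close> is eventually at least \<open>c\<close> if \<open>U\<close> satisfies \<open>\<psi>\<close>, and eventually at most \<open>1 - c\<close>
  if it does not.

  The absorbing graph comes from algebra. Graphs that use only edges \<open>{v, w}\<close> with \<open>p(|v - w|) > 0\<close>
  form a monoid under juxtaposition. Ehrenfeucht--Fraisse types of depth \<open>k\<close> take finitely many values
  on it (\<open>finite_ef_types\<close>), are compatible with juxtaposition (\<open>ef_type_osum\<close>), and do not
  distinguish large powers of a graph (\<open>ef_type_pow\<close>). The monoid of types is therefore finite and
  aperiodic; its minimal ideal is a rectangular band, and every element \<open>e\<close> of a rectangular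
  band that is an ideal satisfies \<open>e x e = e\<close> for all \<open>x\<close> of the monoid (\<open>absorbing_class\<close>). The
  bound \<open>c\<close> is computed in \<open>prob_padded_ge\<close>.
\<close>

section \<open>Juxtaposition of ordered graphs\<close>

text \<open>An ordered graph is a pair of its number \<open>n\<close> of vertices and its set of edges, subsets
  of \<open>{1..n}\<close>. The second summand is shifted behind the first.\<close>

definition osum :: "nat \<times> nat set set \<Rightarrow> nat \<times> nat set set \<Rightarrow> nat \<times> nat set set" where
  "osum G H = (fst G + fst H, snd G \<union> (`) ((+) (fst G)) ` snd H)"

lemma fst_osum [simp]: "fst (osum G H) = fst G + fst H"
  by (simp add: osum_def)

lemma osum_assoc: "osum (osum F G) H = osum F (osum G H)"
  by (simp add: osum_def image_Un image_image Un_assoc add.assoc)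

text \<open>Edges whose length lies in \<open>D\<close>. For \<open>D = {d. 0 < p d}\<close> these are the edges that occur in the
  random graph with positive probability.\<close>

definition step_edges :: "nat set \<Rightarrow> nat \<Rightarrow> nat set set" where
  "step_edges D n = {{v, w} |v w. 1 \<le> v \<and> v < w \<and> w \<le> n \<and> w - v \<in> D}"

definition graph_monoid :: "nat set \<Rightarrow> (nat \<times> nat set set) monoid" where
  "graph_monoid D = \<lparr>carrier = {G. snd G \<subseteq> step_edges D (fst G)}, mult = osum, one = (0, {})\<rparr>"

lemma shift_step_edges: "e \<in> step_edges D m \<Longrightarrow> (+) n ` e \<in> step_edges D (n + m)"
  unfolding step_edges_def
  by (clarsimp, rule_tac x = "n + v" in exI, rule_tac x = "n + w" in exI) auto

lemma step_edges_mono: "n \<le> m \<Longrightarrow> step_edges D n \<subseteq> step_edges D m"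
  unfolding step_edges_def by force

lemma step_edgesD:
  assumes "{v, w} \<in> step_edges D n" "v < w"
  shows "1 \<le> v \<and> w \<le> n \<and> w - v \<in> D"
  using assms by (auto simp: step_edges_def doubleton_eq_iff)

lemma mult_graph_monoid [simp]: "mult (graph_monoid D) = osum"
  and one_graph_monoid [simp]: "one (graph_monoid D) = (0, {})"
  by (simp_all add: graph_monoid_def)

lemma monoid_graph_monoid: "monoid (graph_monoid D)"
proof (rule monoidI)
  fix G H assume "G \<in> carrier (graph_monoid D)" "H \<in> carrier (graph_monoid D)"
  then show "G \<otimes>\<^bsub>graph_monoid D\<^esub> H \<in> carrier (graph_monoid D)"
    using step_edges_mono[of "fst G" "fst G + fst H" D]
    by (auto simp: graph_monoid_def osum_def shift_step_edges subset_iff)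
qed (auto simp: graph_monoid_def osum_assoc, auto simp: osum_def)

lemma carrier_graph_monoid_Pow:
  "G \<in> carrier (graph_monoid D) \<Longrightarrow> snd G \<subseteq> Pow {1..fst G}"
  by (auto simp: graph_monoid_def step_edges_def)

lemma fst_pow_graph_monoid: "fst (G [^]\<^bsub>graph_monoid D\<^esub> m) = m * fst G"
proof -
  interpret monoid "graph_monoid D" by (rule monoid_graph_monoid)
  show ?thesis by (induction m) (auto)
qed

section \<open>An absorbing class in a finite aperiodic quotient\<close>

text \<open>
  The map \<open>f\<close> plays the role of a homomorphism onto a finite aperiodic monoid; the quotient itself
  is not formed. Choose \<open>u\<close> whose two-sided ideal has the fewest classes, and \<open>e = u\<^sup>N\<close>. Then
  \<open>e x e\<close> generates the same ideal, so \<open>e \<sim> a e x e c\<close> for some \<open>a\<close>, \<open>c\<close>. An equation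
  \<open>e \<sim> a e b\<close> can be iterated to \<open>e \<sim> a\<^sup>N e b\<^sup>N\<close>, where aperiodicity lets a further factor \<open>a\<close> or
  \<open>b\<close> be absorbed; so \<open>a e \<sim> e\<close> and, symmetrically, \<open>e b \<sim> e\<close>. Applied to the two ways of
  bracketing \<open>a e x e c\<close>, this strips off \<open>a\<close> and \<open>c\<close> and leaves \<open>e \<sim> e x e\<close>.
\<close>

lemma (in monoid) absorbing_class:
  fixes f :: "'a \<Rightarrow> 'c"
  assumes fin: "finite (f ` carrier G)"
    and cong: "\<And>a x y b. \<lbrakk>a \<in> carrier G; x \<in> carrier G; y \<in> carrier G; b \<in> carrier G; f x = f y\<rbrakk>
      \<Longrightarrow> f (a \<otimes> x \<otimes> b) = f (a \<otimes> y \<otimes> b)"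
    and aper: "\<And>x. x \<in> carrier G \<Longrightarrow> f (x [^] Suc N) = f (x [^] (N::nat))"
    and N: "N > 0"
  shows "\<exists>e\<in>carrier G. \<forall>x\<in>carrier G. f (e \<otimes> x \<otimes> e) = f e"
proof -
  define J where "J u = (\<lambda>(a, b). f (a \<otimes> u \<otimes> b)) ` (carrier G \<times> carrier G)" for u
  have J_sub: "J u \<subseteq> f ` carrier G" if "u \<in> carrier G" for u
    using that by (auto simp: J_def)
  obtain u where u: "u \<in> carrier G" and min: "\<And>w. w \<in> carrier G \<Longrightarrow> card (J u) \<le> card (J w)"
    using arg_min_natI[of "\<lambda>u. u \<in> carrier G" \<one> "\<lambda>u. card (J u)"]
      arg_min_nat_le[of "\<lambda>u. u \<in> carrier G" _ "\<lambda>u. card (J u)"] by blast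
  define e where "e = u [^] N"
  define v where "v = u [^] (N - 1)"
  have e: "e \<in> carrier G" and v: "v \<in> carrier G" and euv: "e = u \<otimes> v"
    using u N nat_pow_mult[OF u, of 1 "N - 1"] by (auto simp: e_def v_def)
  have congL: "f (a \<otimes> x) = f (a \<otimes> y)"
    if "a \<in> carrier G" "x \<in> carrier G" "y \<in> carrier G" "f x = f y" for a x y
    using cong[of a x y \<one>] that by simp
  have congR: "f (x \<otimes> b) = f (y \<otimes> b)"
    if "b \<in> carrier G" "x \<in> carrier G" "y \<in> carrier G" "f x = f y" for b x y
    using cong[of \<one> x y b] that by simp
  have pump: "f (a [^] n \<otimes> e \<otimes> b [^] n) = f e"
    if ab: "a \<in> carrier G" "b \<in> carrier G" and eq: "f (a \<otimes> e \<otimes> b) = f e" for a b and n :: nat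
  proof (induction n)
    case 0
    then show ?case using e by simp
  next
    case (Suc n)
    have "a [^] Suc n \<otimes> e \<otimes> b [^] Suc n = a [^] n \<otimes> (a \<otimes> e \<otimes> b) \<otimes> b [^] n"
      using ab e nat_pow_Suc2[of b n] by (simp add: m_assoc)
    also have "f \<dots> = f (a [^] n \<otimes> e \<otimes> b [^] n)"
      by (rule cong) (use ab e eq in auto)
    finally show ?case using Suc by simp
  qed
  have left: "f (a \<otimes> e) = f e"
    if ab: "a \<in> carrier G" "b \<in> carrier G" and eq: "f (a \<otimes> e \<otimes> b) = f e" for a b
  proof -
    have "f (a \<otimes> e) = f (a \<otimes> (a [^] N \<otimes> e \<otimes> b [^] N))"
      by (rule congL) (use ab e pump[OF ab eq, of N] in auto)
    also have "a \<otimes> (a [^] N \<otimes> e \<otimes> b [^] N) = a [^] Suc N \<otimes> (e \<otimes> b [^] N)"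
      using ab e nat_pow_Suc2[of a N] by (simp add: m_assoc)
    also have "f \<dots> = f (a [^] N \<otimes> (e \<otimes> b [^] N))"
      by (rule congR) (use ab e aper in auto)
    also have "a [^] N \<otimes> (e \<otimes> b [^] N) = a [^] N \<otimes> e \<otimes> b [^] N"
      using ab e by (simp add: m_assoc)
    finally show ?thesis using pump[OF ab eq, of N] by simp
  qed
  have right: "f (e \<otimes> b) = f e"
    if ab: "a \<in> carrier G" "b \<in> carrier G" and eq: "f (a \<otimes> e \<otimes> b) = f e" for a b
  proof -
    have "f (e \<otimes> b) = f ((a [^] N \<otimes> e \<otimes> b [^] N) \<otimes> b)"
      by (rule congR) (use ab e pump[OF ab eq, of N] in auto)
    also have "(a [^] N \<otimes> e \<otimes> b [^] N) \<otimes> b = (a [^] N \<otimes> e) \<otimes> b [^] Suc N"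
      using ab e by (simp add: m_assoc)
    also have "f \<dots> = f ((a [^] N \<otimes> e) \<otimes> b [^] N)"
      by (rule congL) (use ab e aper in auto)
    finally show ?thesis using pump[OF ab eq, of N] by simp
  qed
  have "f (e \<otimes> x \<otimes> e) = f e" if x: "x \<in> carrier G" for x
  proof -
    define w where "w = e \<otimes> x \<otimes> e"
    have w: "w \<in> carrier G" using e x by (simp add: w_def)
    have "J w \<subseteq> J u"
    proof
      fix z assume "z \<in> J w"
      then obtain a b where ab: "a \<in> carrier G" "b \<in> carrier G" and z: "z = f (a \<otimes> w \<otimes> b)"
        by (auto simp: J_def)
      have "a \<otimes> w \<otimes> b = a \<otimes> u \<otimes> (v \<otimes> x \<otimes> e \<otimes> b)"
        using ab u v x e by (simp add: w_def euv m_assoc)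
      then show "z \<in> J u" using ab v x e z by (force simp: J_def)
    qed
    moreover have "finite (J u)" using J_sub[OF u] fin finite_subset by blast
    ultimately have "J w = J u" using min[OF w] by (intro card_seteq) auto
    moreover have "f u \<in> J u"
      using u by (auto simp: J_def intro!: image_eqI[of _ _ "(\<one>, \<one>)"])
    ultimately have "f u \<in> J w" by simp
    then obtain a b where ab: "a \<in> carrier G" "b \<in> carrier G" and fu: "f u = f (a \<otimes> w \<otimes> b)"
      unfolding J_def by auto
    define c where "c = b \<otimes> v"
    have c: "c \<in> carrier G" using ab v by (simp add: c_def)
    have "f e = f (a \<otimes> w \<otimes> b \<otimes> v)"
      unfolding euv by (rule congR) (use ab u v w fu in auto)
    then have eq: "f (a \<otimes> w \<otimes> c) = f e"
      using ab v w by (simp add: c_def m_assoc)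
    have L: "f (a \<otimes> e) = f e"
      by (rule left[of a "x \<otimes> e \<otimes> c"]) (use eq ab x e c in \<open>auto simp: w_def m_assoc\<close>)
    have R: "f (e \<otimes> c) = f e"
      by (rule right[of "a \<otimes> e \<otimes> x" c]) (use eq ab x e c in \<open>auto simp: w_def m_assoc\<close>)
    have "f (e \<otimes> (x \<otimes> e)) = f (a \<otimes> e \<otimes> (x \<otimes> e))"
      by (rule congR) (use ab x e L in auto)
    also have "a \<otimes> e \<otimes> (x \<otimes> e) = (a \<otimes> e \<otimes> x) \<otimes> e"
      using ab x e by (simp add: m_assoc)
    also have "f \<dots> = f ((a \<otimes> e \<otimes> x) \<otimes> (e \<otimes> c))"
      by (rule congL) (use ab x e c R in auto)
    also have "(a \<otimes> e \<otimes> x) \<otimes> (e \<otimes> c) = a \<otimes> w \<otimes> c"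
      using ab x e c by (simp add: w_def m_assoc)
    finally show ?thesis using eq e x by (simp add: m_assoc)
  qed
  then show ?thesis using e by blast
qed

section \<open>Ehrenfeucht--Fraisse types\<close>

text \<open>The value records everything about the \<open>k\<close>-round game on a position, so that equality of values
  is equivalence of positions. A round places one of \<open>K\<close> pebbles, named like the variables of
  formulas.\<close>

datatype game_tree =
  Game_Tree "nat set \<times> (nat \<times> nat) set \<times> (nat \<times> nat) set" "(nat \<times> game_tree) fset"

text \<open>
  The number \<open>0\<close> is not a vertex and serves as the place of a pebble that is not on the board. The
  first component makes it recognisable, so that it behaves like a constant. Letting pebbles rest there
  is what makes positions on a juxtaposition split into positions on both summands.
\<close>

definition diagram :: "nat \<Rightarrow> nat \<times> nat set set \<Rightarrow> (nat \<Rightarrow> nat)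
    \<Rightarrow> nat set \<times> (nat \<times> nat) set \<times> (nat \<times> nat) set" where
  "diagram K G s =
    ({i. i < K \<and> s i = 0}, {(i, j). i < K \<and> j < K \<and> s i \<le> s j},
     {(i, j). i < K \<and> j < K \<and> {s i, s j} \<in> snd G})"

fun ef_type :: "nat \<Rightarrow> nat \<Rightarrow> nat \<times> nat set set \<Rightarrow> (nat \<Rightarrow> nat) \<Rightarrow> game_tree" where
  "ef_type K 0 G s = Game_Tree (diagram K G s) {||}"
| "ef_type K (Suc k) G s = Game_Tree (diagram K G s)
     ((\<lambda>(x, a). (x, ef_type K k G (s(x := a)))) |`|
       fset_of_list (List.product [0..<K] [0..<Suc (fst G)]))"

lemma diagram_eqD:
  assumes "diagram K G s = diagram K H t" "i < K" "j < K"
  shows "s i = 0 \<longleftrightarrow> t i = 0" "s i \<le> s j \<longleftrightarrow> t i \<le> t j" "{s i, s j} \<in> snd G \<longleftrightarrow> {t i, t j} \<in> snd H"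
proof -
  have eqs: "{i. i < K \<and> s i = 0} = {i. i < K \<and> t i = 0}"
    "{(i, j). i < K \<and> j < K \<and> s i \<le> s j} = {(i, j). i < K \<and> j < K \<and> t i \<le> t j}"
    "{(i, j). i < K \<and> j < K \<and> {s i, s j} \<in> snd G} = {(i, j). i < K \<and> j < K \<and> {t i, t j} \<in> snd H}"
    using assms(1) unfolding diagram_def prod.inject by simp_all
  show "s i = 0 \<longleftrightarrow> t i = 0"
    using arg_cong[OF eqs(1), of "\<lambda>S. i \<in> S"] assms(2) by simp
  show "s i \<le> s j \<longleftrightarrow> t i \<le> t j"
    using arg_cong[OF eqs(2), of "\<lambda>S. (i, j) \<in> S"] assms(2,3) by simp
  show "{s i, s j} \<in> snd G \<longleftrightarrow> {t i, t j} \<in> snd H"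
    using arg_cong[OF eqs(3), of "\<lambda>S. (i, j) \<in> S"] assms(2,3) by simp
qed

lemma diagram_eqI:
  assumes "\<And>i. i < K \<Longrightarrow> s i = 0 \<longleftrightarrow> t i = 0"
    "\<And>i j. i < K \<Longrightarrow> j < K \<Longrightarrow> s i \<le> s j \<longleftrightarrow> t i \<le> t j"
    "\<And>i j. i < K \<Longrightarrow> j < K \<Longrightarrow> {s i, s j} \<in> snd G \<longleftrightarrow> {t i, t j} \<in> snd H"
  shows "diagram K G s = diagram K H t"
  using assms unfolding diagram_def by auto

lemma ef_type_diagram: "ef_type K k G s = ef_type K k H t \<Longrightarrow> diagram K G s = diagram K H t"
  by (cases k) auto

lemma tagged_image_subset_iff:
  "(\<lambda>(x, a). (x, f x a)) ` (X \<times> A) \<subseteq> (\<lambda>(x, b). (x, g x b)) ` (X \<times> B) \<longleftrightarrow>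
    (\<forall>x\<in>X. \<forall>a\<in>A. \<exists>b\<in>B. f x a = g x b)"
  unfolding image_subset_iff by (auto simp: image_iff Bex_def)

lemma ef_type_Suc_eq_iff:
  "ef_type K (Suc k) G s = ef_type K (Suc k) H t \<longleftrightarrow>
    diagram K G s = diagram K H t \<and>
    (\<forall>x<K. \<forall>a\<le>fst G. \<exists>b\<le>fst H. ef_type K k G (s(x := a)) = ef_type K k H (t(x := b))) \<and>
    (\<forall>x<K. \<forall>b\<le>fst H. \<exists>a\<le>fst G. ef_type K k H (t(x := b)) = ef_type K k G (s(x := a)))"
proof -
  have "(\<lambda>(x, a). (x, ef_type K k G (s(x := a)))) |`|
       fset_of_list (List.product [0..<K] [0..<Suc (fst G)]) =
     (\<lambda>(x, a). (x, ef_type K k H (t(x := a)))) |`|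
       fset_of_list (List.product [0..<K] [0..<Suc (fst H)]) \<longleftrightarrow>
     (\<lambda>(x, a). (x, ef_type K k G (s(x := a)))) ` ({..<K} \<times> {..fst G}) =
     (\<lambda>(x, a). (x, ef_type K k H (t(x := a)))) ` ({..<K} \<times> {..fst H})"
    unfolding fset_inject[symmetric] fimage.rep_eq fset_of_list.rep_eq set_product
      set_upt atLeast0LessThan lessThan_Suc_atMost ..
  also have "\<dots> \<longleftrightarrow>
    (\<forall>x<K. \<forall>a\<le>fst G. \<exists>b\<le>fst H. ef_type K k G (s(x := a)) = ef_type K k H (t(x := b))) \<and>
    (\<forall>x<K. \<forall>b\<le>fst H. \<exists>a\<le>fst G. ef_type K k H (t(x := b)) = ef_type K k G (s(x := a)))"
    unfolding set_eq_subset tagged_image_subset_iff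
    by (simp only: Ball_def Bex_def lessThan_iff atMost_iff)
  finally show ?thesis by simp
qed

lemma finite_ef_types: "finite (range (\<lambda>(G, s). ef_type K k G s))"
proof (induction k)
  let ?D = "Pow {..<K} \<times> Pow ({..<K} \<times> {..<K}) \<times> Pow ({..<K} \<times> {..<K})"
  have D: "diagram K G s \<in> ?D" for G s by (auto simp: diagram_def)
  {
    case 0
    have "range (\<lambda>(G, s). ef_type K 0 G s) \<subseteq> (\<lambda>d. Game_Tree d {||}) ` ?D"
      using D by auto
    then show ?case by (rule finite_subset) simp
  next
    case (Suc k)
    let ?T = "{..<K} \<times> range (\<lambda>(G, s). ef_type K k G s)"
    have fin: "finite (fset -` Pow ?T)"
      by (rule finite_vimageI) (use Suc in \<open>auto simp: inj_def fset_inject\<close>)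
    have "range (\<lambda>(G, s). ef_type K (Suc k) G s) \<subseteq> (\<lambda>(d, A). Game_Tree d A) ` (?D \<times> (fset -` Pow ?T))"
    proof (clarify, rule image_eqI)
      fix n E s
      show "ef_type K (Suc k) (n, E) s = (\<lambda>(d, A). Game_Tree d A) (diagram K (n, E) s,
         (\<lambda>(x, a). (x, ef_type K k (n, E) (s(x := a)))) |`|
       fset_of_list (List.product [0..<K] [0..<Suc (fst (n, E))]))" by simp
      show "(diagram K (n, E) s,
         (\<lambda>(x, a). (x, ef_type K k (n, E) (s(x := a)))) |`|
       fset_of_list (List.product [0..<K] [0..<Suc (fst (n, E))])) \<in> ?D \<times> (fset -` Pow ?T)"
        using D[of "(n, E)" s] by (fastforce simp: fset_of_list.rep_eq image_iff)
    qed
    then show ?case by (rule finite_subset) (intro finite_imageI finite_cartesian_product fin, auto)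
  }
qed

fun qdepth :: "fo_fm \<Rightarrow> nat" where
  "qdepth (FNot \<phi>) = qdepth \<phi>"
| "qdepth (FAnd \<phi> \<psi>) = max (qdepth \<phi>) (qdepth \<psi>)"
| "qdepth (FEx x \<phi>) = Suc (qdepth \<phi>)"
| "qdepth _ = 0"

fun var_bound :: "fo_fm \<Rightarrow> nat" where
  "var_bound (FEq x y) = Suc (max x y)"
| "var_bound (FAdj x y) = Suc (max x y)"
| "var_bound (FLe x y) = Suc (max x y)"
| "var_bound (FNot \<phi>) = var_bound \<phi>"
| "var_bound (FAnd \<phi> \<psi>) = max (var_bound \<phi>) (var_bound \<psi>)"
| "var_bound (FEx x \<phi>) = max (Suc x) (var_bound \<phi>)"

text \<open>Bounded quantifiers range over \<open>{1..n}\<close> and moves over \<open>{0..n}\<close>; this does no harm, since a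
  move to the distinguished place \<open>0\<close> can only be answered by \<open>0\<close>.\<close>

lemma sat_eq_if_ef_type_eq:
  assumes "ef_type K k G s = ef_type K k H t" "qdepth \<phi> \<le> k" "var_bound \<phi> \<le> K"
  shows "sat (fst G) (snd G) s \<phi> \<longleftrightarrow> sat (fst H) (snd H) t \<phi>"
  using assms
proof (induction \<phi> arbitrary: k s t)
  case (FEq x y)
  then show ?case
    using diagram_eqD(2)[OF ef_type_diagram, of K k G s H t x y]
      diagram_eqD(2)[OF ef_type_diagram, of K k G s H t y x] by (auto simp: eq_iff)
next
  case (FAdj x y)
  then show ?case using diagram_eqD(3)[OF ef_type_diagram, of K k G s H t x y] by auto
next
  case (FLe x y)
  then show ?case using diagram_eqD(2)[OF ef_type_diagram, of K k G s H t x y] by auto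
next
  case (FEx x \<phi>)
  then obtain j where k: "k = Suc j" by (cases k) auto
  have x: "x < K" using FEx.prems by simp
  have nz: "a = 0 \<longleftrightarrow> b = 0" if "ef_type K j G (s(x := a)) = ef_type K j H (t(x := b))" for a b
    using diagram_eqD(1)[OF ef_type_diagram[OF that] x x] by simp
  have IH: "sat (fst G) (snd G) (s(x := a)) \<phi> \<longleftrightarrow> sat (fst H) (snd H) (t(x := b)) \<phi>"
    if "ef_type K j G (s(x := a)) = ef_type K j H (t(x := b))" for a b
    by (rule FEx.IH[OF that]) (use FEx.prems k in auto)
  have forth: "\<exists>b\<le>fst H. ef_type K j G (s(x := a)) = ef_type K j H (t(x := b))" if "a \<le> fst G" for a
    using FEx.prems(1) x that unfolding k ef_type_Suc_eq_iff by blast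
  have backwd: "\<exists>a\<le>fst G. ef_type K j G (s(x := a)) = ef_type K j H (t(x := b))" if "b \<le> fst H" for b
    using FEx.prems(1) x that unfolding k ef_type_Suc_eq_iff by metis
  show ?case
  proof
    assume "sat (fst G) (snd G) s (FEx x \<phi>)"
    then obtain a where a: "1 \<le> a" "a \<le> fst G" "sat (fst G) (snd G) (s(x := a)) \<phi>" by auto
    obtain b where b: "b \<le> fst H" "ef_type K j G (s(x := a)) = ef_type K j H (t(x := b))"
      using forth[OF a(2)] by blast
    show "sat (fst H) (snd H) t (FEx x \<phi>)"
      using a b nz[OF b(2)] IH[OF b(2)] by (auto intro!: bexI[of _ b])
  next
    assume "sat (fst H) (snd H) t (FEx x \<phi>)"
    then obtain b where b: "1 \<le> b" "b \<le> fst H" "sat (fst H) (snd H) (t(x := b)) \<phi>" by auto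
    obtain a where a: "a \<le> fst G" "ef_type K j G (s(x := a)) = ef_type K j H (t(x := b))"
      using backwd[OF b(2)] by blast
    show "sat (fst G) (snd G) s (FEx x \<phi>)"
      using a b nz[OF a(2)] IH[OF a(2)] by (auto intro!: bexI[of _ a])
  qed
qed auto

lemma sat_cong_free_vars:
  "(\<And>x. x \<in> free_vars \<phi> \<Longrightarrow> s x = t x) \<Longrightarrow> sat n E s \<phi> \<longleftrightarrow> sat n E t \<phi>"
proof (induction \<phi> arbitrary: s t)
  case (FAnd \<phi>1 \<phi>2)
  have "sat n E s \<phi>1 \<longleftrightarrow> sat n E t \<phi>1" "sat n E s \<phi>2 \<longleftrightarrow> sat n E t \<phi>2"
    by (rule FAnd.IH(1), simp add: FAnd.prems) (rule FAnd.IH(2), simp add: FAnd.prems)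
  then show ?case by simp
next
  case (FNot \<phi>)
  have "sat n E s \<phi> \<longleftrightarrow> sat n E t \<phi>"
    by (rule FNot.IH) (simp add: FNot.prems)
  then show ?case by simp
next
  case (FEx x \<phi>)
  have "sat n E (s(x := a)) \<phi> \<longleftrightarrow> sat n E (t(x := a)) \<phi>" for a
    by (rule FEx.IH) (use FEx.prems in auto)
  then show ?case by simp
qed simp_all

lemma holds_in_sentence_iff:
  assumes "sentence \<psi>" "n \<ge> 1"
  shows "holds_in n E \<psi> \<longleftrightarrow> sat n E (\<lambda>_. 0) \<psi>"
proof -
  have "sat n E s \<psi> \<longleftrightarrow> sat n E (\<lambda>_. 0) \<psi>" for s
    by (rule sat_cong_free_vars) (use assms in \<open>simp add: sentence_def\<close>)
  moreover have "range (\<lambda>_::nat. 1::nat) \<subseteq> {1..n}" using assms by auto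
  ultimately show ?thesis unfolding holds_in_def by blast
qed

section \<open>Types of juxtapositions\<close>

text \<open>The position on a juxtaposition whose parts on the two summands are \<open>s\<close> and \<open>t\<close>; no
  pebble may be on both parts.\<close>

definition glue :: "nat \<Rightarrow> (nat \<Rightarrow> nat) \<Rightarrow> (nat \<Rightarrow> nat) \<Rightarrow> nat \<Rightarrow> nat" where
  "glue n s t = (\<lambda>i. if t i = 0 then s i else n + t i)"

definition separated :: "nat \<times> nat set set \<Rightarrow> nat \<times> nat set set \<Rightarrow> (nat \<Rightarrow> nat) \<Rightarrow> (nat \<Rightarrow> nat) \<Rightarrow> bool" where
  "separated G H s t \<longleftrightarrow> snd G \<subseteq> Pow {1..fst G} \<and> snd H \<subseteq> Pow {1..fst H} \<and>
    (\<forall>i. s i \<le> fst G \<and> t i \<le> fst H \<and> (s i = 0 \<or> t i = 0))"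

lemma glue_atoms:
  assumes "separated G H s t"
  shows "glue (fst G) s t i = 0 \<longleftrightarrow> s i = 0 \<and> t i = 0"
    and "glue (fst G) s t i \<le> glue (fst G) s t j \<longleftrightarrow>
      (if t j = 0 then t i = 0 \<and> s i \<le> s j else t i = 0 \<or> t i \<le> t j)"
    and "{glue (fst G) s t i, glue (fst G) s t j} \<in> snd (osum G H) \<longleftrightarrow>
      t i = 0 \<and> t j = 0 \<and> {s i, s j} \<in> snd G \<or> {t i, t j} \<in> snd H"
proof -
  have b: "s i \<le> fst G" "t i \<le> fst H" "s j \<le> fst G" for i j
    using assms by (auto simp: separated_def)
  show "glue (fst G) s t i = 0 \<longleftrightarrow> s i = 0 \<and> t i = 0"
    by (simp add: glue_def)
  show "glue (fst G) s t i \<le> glue (fst G) s t j \<longleftrightarrow>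
      (if t j = 0 then t i = 0 \<and> s i \<le> s j else t i = 0 \<or> t i \<le> t j)"
    using b[of i] b[of j] by (auto simp: glue_def)
  let ?u = "glue (fst G) s t"
  have GP: "snd G \<subseteq> Pow {1..fst G}" and HP: "snd H \<subseteq> Pow {1..fst H}"
    using assms by (auto simp: separated_def)
  have 1: "{?u i, ?u j} \<in> snd G \<longleftrightarrow> t i = 0 \<and> t j = 0 \<and> {s i, s j} \<in> snd G"
    using GP by (auto simp: glue_def split: if_splits)
  have 2: "{?u i, ?u j} \<in> (`) ((+) (fst G)) ` snd H \<longleftrightarrow> {t i, t j} \<in> snd H"
  proof
    assume "{t i, t j} \<in> snd H"
    moreover from this have "t i \<noteq> 0" "t j \<noteq> 0" using HP by auto
    ultimately show "{?u i, ?u j} \<in> (`) ((+) (fst G)) ` snd H"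
      by (intro image_eqI[of _ _ "{t i, t j}"]) (auto simp: glue_def)
  next
    assume "{?u i, ?u j} \<in> (`) ((+) (fst G)) ` snd H"
    then obtain e where e: "e \<in> snd H" "{?u i, ?u j} = (+) (fst G) ` e" by auto
    have pos: "x \<ge> 1" if "x \<in> e" for x using subsetD[OF HP e(1)] that by auto
    have gt: "t l \<noteq> 0" if l: "?u l \<in> (+) (fst G) ` e" for l
    proof -
      obtain x where "x \<in> e" "?u l = fst G + x" using l by auto
      then show ?thesis using pos[of x] b(1)[of l] by (auto simp: glue_def split: if_splits)
    qed
    have "?u i \<in> (+) (fst G) ` e" "?u j \<in> (+) (fst G) ` e" using e(2) by auto
    then have "t i \<noteq> 0" "t j \<noteq> 0" using gt by blast+
    then have "{?u i, ?u j} = (+) (fst G) ` {t i, t j}" by (simp add: glue_def)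
    then have "e = {t i, t j}" using e(2) by (metis inj_image_eq_iff inj_on_add)
    then show "{t i, t j} \<in> snd H" using e(1) by simp
  qed
  show "{?u i, ?u j} \<in> snd (osum G H) \<longleftrightarrow>
      t i = 0 \<and> t j = 0 \<and> {s i, s j} \<in> snd G \<or> {t i, t j} \<in> snd H"
    using 1 2 by (simp add: osum_def)
qed

text \<open>The duplicator answers a move in one summand by a strategy for that summand. The pebble is at
  the same time taken off the other summand, which there is a move to \<open>0\<close>.\<close>

lemma ef_type_osum:
  assumes "separated G H s t" "separated G' H' s' t'"
    and "ef_type K k G s = ef_type K k G' s'" "ef_type K k H t = ef_type K k H' t'"
  shows "ef_type K k (osum G H) (glue (fst G) s t) = ef_type K k (osum G' H') (glue (fst G') s' t')"
  using assms
proof (induction k arbitrary: s t s' t' G H G' H')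
  case (0 s t s' t' G H G' H')
  have d: "diagram K G s = diagram K G' s'" "diagram K H t = diagram K H' t'"
    using 0 by auto
  have "diagram K (osum G H) (glue (fst G) s t) = diagram K (osum G' H') (glue (fst G') s' t')"
    by (rule diagram_eqI) (simp_all add: glue_atoms[OF 0(1)] glue_atoms[OF 0(2)]
        diagram_eqD[OF d(1)] diagram_eqD[OF d(2)])
  then show ?case by simp
next
  case (Suc k s t s' t' G H G' H')
  have forth: "\<exists>b\<le>fst (osum G' H'). ef_type K k (osum G H) ((glue (fst G) s t)(x := a)) =
      ef_type K k (osum G' H') ((glue (fst G') s' t')(x := b))"
    if sep: "separated G H s t" "separated G' H' s' t'"
      and eq: "ef_type K (Suc k) G s = ef_type K (Suc k) G' s'"
        "ef_type K (Suc k) H t = ef_type K (Suc k) H' t'"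
      and x: "x < K" and a: "a \<le> fst (osum G H)" for s t s' t' G H G' H' x a
  proof -
    \<comment> \<open>The two parts of the new place \<open>a\<close>; truncated subtraction gives \<open>0\<close> if \<open>a\<close> lies in \<open>G\<close>.\<close>
    define a1 where "a1 = (if a \<le> fst G then a else 0)"
    define a2 where "a2 = a - fst G"
    have a12: "a1 \<le> fst G" "a2 \<le> fst H" "a1 = 0 \<or> a2 = 0"
      using a by (auto simp: a1_def a2_def)
    obtain b1 where b1: "b1 \<le> fst G'" "ef_type K k G (s(x := a1)) = ef_type K k G' (s'(x := b1))"
      using eq(1) x a12(1) unfolding ef_type_Suc_eq_iff by blast
    obtain b2 where b2: "b2 \<le> fst H'" "ef_type K k H (t(x := a2)) = ef_type K k H' (t'(x := b2))"
      using eq(2) x a12(2) unfolding ef_type_Suc_eq_iff by blast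
    have z: "a1 = 0 \<longleftrightarrow> b1 = 0" "a2 = 0 \<longleftrightarrow> b2 = 0"
      using diagram_eqD(1)[OF ef_type_diagram[OF b1(2)] x x]
        diagram_eqD(1)[OF ef_type_diagram[OF b2(2)] x x] by auto
    define b where "b = (if b2 = 0 then b1 else fst G' + b2)"
    have "ef_type K k (osum G H) (glue (fst G) (s(x := a1)) (t(x := a2))) =
        ef_type K k (osum G' H') (glue (fst G') (s'(x := b1)) (t'(x := b2)))"
    proof (rule Suc.IH)
      show "separated G H (s(x := a1)) (t(x := a2))"
        using sep(1) a12 by (auto simp: separated_def)
      show "separated G' H' (s'(x := b1)) (t'(x := b2))"
        using sep(2) a12 z b1(1) b2(1) by (auto simp: separated_def)
    qed (fact b1(2) b2(2))+
    moreover have "glue (fst G) (s(x := a1)) (t(x := a2)) = (glue (fst G) s t)(x := a)"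
      by (auto simp: glue_def fun_eq_iff a1_def a2_def)
    moreover have "glue (fst G') (s'(x := b1)) (t'(x := b2)) = (glue (fst G') s' t')(x := b)"
      by (auto simp: glue_def fun_eq_iff b_def)
    moreover have "b \<le> fst (osum G' H')"
      using b1(1) b2(1) by (simp add: b_def)
    ultimately show ?thesis by metis
  qed
  have d: "diagram K G s = diagram K G' s'" "diagram K H t = diagram K H' t'"
    using ef_type_diagram[OF Suc.prems(3)] ef_type_diagram[OF Suc.prems(4)] by auto
  have "diagram K (osum G H) (glue (fst G) s t) = diagram K (osum G' H') (glue (fst G') s' t')"
    by (rule diagram_eqI) (simp_all add: glue_atoms[OF Suc.prems(1)] glue_atoms[OF Suc.prems(2)]
        diagram_eqD[OF d(1)] diagram_eqD[OF d(2)])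
  then show ?case
    unfolding ef_type_Suc_eq_iff
    using forth[OF Suc.prems]
      forth[OF Suc.prems(2,1) Suc.prems(3)[symmetric] Suc.prems(4)[symmetric]] by blast
qed

lemma glue_zero [simp]: "glue n (\<lambda>_. 0) (\<lambda>_. 0) = (\<lambda>_. 0)"
  by (simp add: glue_def)

text \<open>
  First-order logic cannot count beyond \<open>2\<^sup>k\<close>, as for finite linear orders. A first move falls into one
  copy of \<open>G\<close> and leaves \<open>i\<close> copies before it and \<open>j\<close> behind it. One of the two numbers is large
  enough for the induction hypothesis to change it by one, and the duplicator plays the same vertex in
  the copy of \<open>G\<close> that has the adjusted number of copies on that side.
\<close>

lemma ef_type_pow:
  assumes G: "G \<in> carrier (graph_monoid D)" and m: "2 ^ k \<le> Suc m"
  shows "ef_type K k (G [^]\<^bsub>graph_monoid D\<^esub> Suc m) (\<lambda>_. 0) =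
    ef_type K k (G [^]\<^bsub>graph_monoid D\<^esub> m) (\<lambda>_. 0)"
  using m
proof (induction k arbitrary: m)
  interpret monoid "graph_monoid D" by (rule monoid_graph_monoid)
  let ?n = "fst G"
  let ?pw = "\<lambda>m::nat. G [^]\<^bsub>graph_monoid D\<^esub> m"
  have Pow: "snd (?pw m) \<subseteq> Pow {1..fst (?pw m)}" for m
    using carrier_graph_monoid_Pow[OF nat_pow_closed[OF G]] .
  have fst_pw: "fst (?pw m) = m * ?n" for m by (rule fst_pow_graph_monoid)
  have diag: "diagram K (?pw m) (\<lambda>_. 0) = diagram K (?pw m') (\<lambda>_. 0)" for m m'
    using Pow[of m] Pow[of m'] by (intro diagram_eqI) auto
  {
    case 0
    show ?case using diag[of "Suc m" m] by (simp only: ef_type.simps)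
  next
    case (Suc k)
    have split: "?pw (Suc (i + j)) = osum (?pw i) (osum G (?pw j))" for i j
      using nat_pow_mult[OF G, of i "Suc j"] nat_pow_Suc2[OF G, of j] by simp
    have move: "ef_type K k (?pw (Suc (i + j))) ((\<lambda>_. 0)(y := i * ?n + c)) =
        ef_type K k (?pw (Suc (i' + j'))) ((\<lambda>_. 0)(y := i' * ?n + c))"
      if i: "ef_type K k (?pw i) (\<lambda>_. 0) = ef_type K k (?pw i') (\<lambda>_. 0)"
        and j: "ef_type K k (?pw j) (\<lambda>_. 0) = ef_type K k (?pw j') (\<lambda>_. 0)"
        and c: "1 \<le> c" "c \<le> ?n" for i j i' j' c y
    proof -
      let ?s = "(\<lambda>_. 0)(y := c) :: nat \<Rightarrow> nat"
      have asg: "(\<lambda>_. 0)(y := i * ?n + c) = glue (fst (?pw i)) (\<lambda>_. 0) (glue ?n ?s (\<lambda>_. 0))" for i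
        using c by (auto simp: glue_def fst_pw)
      have sepG: "separated G (?pw j) ?s (\<lambda>_. 0)" for j
        using c carrier_graph_monoid_Pow[OF G] Pow[of j] by (auto simp: separated_def)
      have sep: "separated (?pw i) (osum G (?pw j)) (\<lambda>_. 0) (glue ?n ?s (\<lambda>_. 0))" for i j
        using c Pow[of i] carrier_graph_monoid_Pow[of "osum G (?pw j)" D]
          m_closed[OF G nat_pow_closed[OF G, of j]]
        by (auto simp: separated_def glue_def)
      show ?thesis
        unfolding split asg by (intro ef_type_osum sep sepG i j refl)
    qed
    have zero: "ef_type K k (?pw (Suc m)) (\<lambda>_. 0) = ef_type K k (?pw m) (\<lambda>_. 0)"
      by (rule Suc.IH) (use Suc.prems in simp)
    have shrink: "ef_type K k (?pw l) (\<lambda>_. 0) = ef_type K k (?pw (l - 1)) (\<lambda>_. 0)"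
      if "2 ^ k \<le> l" for l
    proof -
      have "l \<noteq> 0" using that zero_less_power[of "2::nat" k] by linarith
      then obtain l' where "l = Suc l'" using not0_implies_Suc by blast
      then show ?thesis using Suc.IH[of l'] that by simp
    qed
    \<comment> \<open>Vertex \<open>a\<close> of a power is vertex \<open>c\<close> of the copy that is preceded by \<open>i\<close> others.\<close>
    have pos: "\<exists>i c. a = i * ?n + c \<and> 1 \<le> c \<and> c \<le> ?n \<and> i < l"
      if a: "a \<le> l * ?n" "a \<noteq> 0" for a l
    proof (intro exI conjI)
      have n: "?n > 0" using a by (cases "?n") auto
      show "a = (a - 1) div ?n * ?n + Suc ((a - 1) mod ?n)"
        using a(2) div_mult_mod_eq[of "a - 1" ?n] by linarith
      show "Suc ((a - 1) mod ?n) \<le> ?n" using n by (simp add: Suc_leI)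
      show "(a - 1) div ?n < l" using a n by (simp add: div_less_iff_less_mult)
    qed simp
    have forth: "\<exists>b\<le>m * ?n. ef_type K k (?pw (Suc m)) ((\<lambda>_. 0)(y := a)) =
        ef_type K k (?pw m) ((\<lambda>_. 0)(y := b))" if a: "a \<le> Suc m * ?n" for y a
    proof (cases "a = 0")
      case True
      then show ?thesis using zero by (intro exI[of _ 0]) (simp add: fun_upd_idem)
    next
      case False
      obtain i c where ic: "a = i * ?n + c" "1 \<le> c" "c \<le> ?n" "i < Suc m"
        using pos[OF a False] by blast
      define j where "j = m - i"
      have mij: "m = i + j" using ic by (simp add: j_def)
      obtain i' j' where ij': "m = Suc (i' + j')"
        "ef_type K k (?pw i) (\<lambda>_. 0) = ef_type K k (?pw i') (\<lambda>_. 0)"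
        "ef_type K k (?pw j) (\<lambda>_. 0) = ef_type K k (?pw j') (\<lambda>_. 0)"
      proof (cases "2 ^ k \<le> i")
        case True
        moreover from True have "i > 0" using zero_less_power[of "2::nat" k] by linarith
        ultimately show ?thesis using that[of "i - 1" j] mij shrink[of i] by simp
      next
        case False
        then have "2 ^ k \<le> j" using Suc.prems mij by simp
        moreover from this have "j > 0" using zero_less_power[of "2::nat" k] by linarith
        ultimately show ?thesis using that[of i "j - 1"] mij shrink[of j] by simp
      qed
      have "i' * ?n + c \<le> Suc (i' + j') * ?n" using ic by (simp add: add_mult_distrib)
      then show ?thesis
        using move[OF ij'(2,3) ic(2,3), of y] ic(1) mij ij'(1) by metis
    qed
    have backwd: "\<exists>a\<le>Suc m * ?n. ef_type K k (?pw m) ((\<lambda>_. 0)(y := b)) =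
        ef_type K k (?pw (Suc m)) ((\<lambda>_. 0)(y := a))" if b: "b \<le> m * ?n" for y b
    proof (cases "b = 0")
      case True
      then show ?thesis using zero by (intro exI[of _ 0]) (simp add: fun_upd_idem)
    next
      case False
      obtain i c where ic: "b = i * ?n + c" "1 \<le> c" "c \<le> ?n" "i < m"
        using pos[OF b False] by blast
      define j where "j = m - Suc i"
      have mij: "m = Suc (i + j)" using ic by (simp add: j_def)
      obtain i' j' where ij': "m = i' + j'"
        "ef_type K k (?pw i) (\<lambda>_. 0) = ef_type K k (?pw i') (\<lambda>_. 0)"
        "ef_type K k (?pw j) (\<lambda>_. 0) = ef_type K k (?pw j') (\<lambda>_. 0)"
      proof (cases "2 ^ k \<le> Suc i")
        case True
        then show ?thesis using that[of "Suc i" j] mij shrink[of "Suc i"] by simp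
      next
        case False
        then have "2 ^ k \<le> Suc j" using Suc.prems mij by simp
        then show ?thesis using that[of i "Suc j"] mij shrink[of "Suc j"] by simp
      qed
      have "i' * ?n + c \<le> Suc (i' + j') * ?n" using ic by (simp add: algebra_simps)
      then show ?thesis
        using move[OF ij'(2,3) ic(2,3), of y] ic(1) mij ij'(1) by metis
    qed
    show ?case
      unfolding ef_type_Suc_eq_iff fst_pw using diag forth backwd by blast
  }
qed

lemma exists_absorbing_graph:
  "\<exists>U\<in>carrier (graph_monoid D). \<forall>X\<in>carrier (graph_monoid D).
    ef_type K k (osum (osum U X) U) (\<lambda>_. 0) = ef_type K k U (\<lambda>_. 0)"
proof -
  interpret monoid "graph_monoid D" by (rule monoid_graph_monoid)
  have sep: "separated G H (\<lambda>_. 0) (\<lambda>_. 0)"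
    if "G \<in> carrier (graph_monoid D)" "H \<in> carrier (graph_monoid D)" for G H
    using carrier_graph_monoid_Pow[OF that(1)] carrier_graph_monoid_Pow[OF that(2)]
    by (simp add: separated_def)
  have cong: "ef_type K k (osum G H) (\<lambda>_. 0) = ef_type K k (osum G' H') (\<lambda>_. 0)"
    if "G \<in> carrier (graph_monoid D)" "H \<in> carrier (graph_monoid D)"
      "G' \<in> carrier (graph_monoid D)" "H' \<in> carrier (graph_monoid D)"
      "ef_type K k G (\<lambda>_. 0) = ef_type K k G' (\<lambda>_. 0)"
      "ef_type K k H (\<lambda>_. 0) = ef_type K k H' (\<lambda>_. 0)" for G H G' H'
    using ef_type_osum[OF sep[OF that(1,2)] sep[OF that(3,4)] that(5,6)] by simp
  have "\<exists>U\<in>carrier (graph_monoid D). \<forall>X\<in>carrier (graph_monoid D).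
    ef_type K k (U \<otimes>\<^bsub>graph_monoid D\<^esub> X \<otimes>\<^bsub>graph_monoid D\<^esub> U) (\<lambda>_. 0) = ef_type K k U (\<lambda>_. 0)"
  proof (rule absorbing_class[where N = "2 ^ k" and f = "\<lambda>G. ef_type K k G (\<lambda>_. 0)"])
    show "finite ((\<lambda>G. ef_type K k G (\<lambda>_. 0)) ` carrier (graph_monoid D))"
      by (rule finite_subset[OF _ finite_ef_types[of K k]]) auto
    show "ef_type K k (G [^]\<^bsub>graph_monoid D\<^esub> Suc (2 ^ k)) (\<lambda>_. 0) =
        ef_type K k (G [^]\<^bsub>graph_monoid D\<^esub> ((2::nat) ^ k)) (\<lambda>_. 0)"
      if "G \<in> carrier (graph_monoid D)" for G
      by (rule ef_type_pow[OF that]) simp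
    show "ef_type K k (A \<otimes>\<^bsub>graph_monoid D\<^esub> X \<otimes>\<^bsub>graph_monoid D\<^esub> B) (\<lambda>_. 0) =
        ef_type K k (A \<otimes>\<^bsub>graph_monoid D\<^esub> Y \<otimes>\<^bsub>graph_monoid D\<^esub> B) (\<lambda>_. 0)"
      if "A \<in> carrier (graph_monoid D)" "X \<in> carrier (graph_monoid D)"
        "Y \<in> carrier (graph_monoid D)" "B \<in> carrier (graph_monoid D)"
        "ef_type K k X (\<lambda>_. 0) = ef_type K k Y (\<lambda>_. 0)" for A X Y B
      using that m_closed[of A X] m_closed[of A Y] unfolding mult_graph_monoid
      by (intro cong) auto
  qed simp
  then show ?thesis by simp
qed

section \<open>The random graph starts and ends with a given graph\<close>

text \<open>Prescribing all pairs that meet the first or the last \<open>L\<close> vertices forces the edges of both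
  copies of \<open>(L, A)\<close> and separates them from the rest. The summand in between is the graph
  induced on the other vertices.\<close>

lemma padded_decomposition:
  assumes A: "A \<subseteq> step_edges D L" and n: "2 * L \<le> n"
    and outer: "\<And>v w. \<lbrakk>1 \<le> v; v < w; w \<le> n; v \<le> L \<or> n - L < w\<rbrakk> \<Longrightarrow>
      X (v, w) \<longleftrightarrow> {v, w} \<in> A \<or> {v, w} \<in> (`) ((+) (n - L)) ` A"
    and inner: "\<And>v w. \<lbrakk>1 \<le> v; v < w; w \<le> n; X (v, w)\<rbrakk> \<Longrightarrow> w - v \<in> D"
  shows "\<exists>H\<in>carrier (graph_monoid D).
    (n, {{v, w} |v w. 1 \<le> v \<and> v < w \<and> w \<le> n \<and> X (v, w)}) = osum (osum (L, A) H) (L, A)"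
proof
  define B where "B = {{v, w} |v w. 1 \<le> v \<and> v < w \<and> w \<le> n - 2 * L \<and> X (v + L, w + L)}"
  show "(n - 2 * L, B) \<in> carrier (graph_monoid D)"
  proof -
    have "w - v \<in> D" if "1 \<le> v" "v < w" "w \<le> n - 2 * L" "X (v + L, w + L)" for v w
      using inner[of "v + L" "w + L"] that n by simp
    then show ?thesis unfolding B_def graph_monoid_def step_edges_def by auto
  qed
  let ?E = "{{v, w} |v w. 1 \<le> v \<and> v < w \<and> w \<le> n \<and> X (v, w)}"
  have "?E = A \<union> (`) ((+) L) ` B \<union> (`) ((+) (n - L)) ` A"
  proof (intro equalityI subsetI)
    fix e assume "e \<in> ?E"
    then obtain v w where e: "e = {v, w}" and vw: "1 \<le> v" "v < w" "w \<le> n" "X (v, w)" by auto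
    show "e \<in> A \<union> (`) ((+) L) ` B \<union> (`) ((+) (n - L)) ` A"
    proof (cases "v \<le> L \<or> n - L < w")
      case True
      then show ?thesis using outer[OF vw(1-3)] vw(4) e by auto
    next
      case False
      then have "{v - L, w - L} \<in> B" "{v, w} = (+) L ` {v - L, w - L}"
        using vw n unfolding B_def mem_Collect_eq
        by - (rule exI[of _ "v - L"], rule exI[of _ "w - L"], auto)
      then show ?thesis using e by blast
    qed
  next
    fix e assume "e \<in> A \<union> (`) ((+) L) ` B \<union> (`) ((+) (n - L)) ` A"
    then consider (a) "e \<in> A" | (b) "e \<in> (`) ((+) L) ` B" | (c) "e \<in> (`) ((+) (n - L)) ` A" by auto
    then show "e \<in> ?E"
    proof cases
      case a
      then obtain v w where e: "e = {v, w}" and vw: "1 \<le> v" "v < w" "w \<le> L"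
        using A by (auto simp: step_edges_def)
      have "X (v, w)" using outer[of v w] vw n a e by auto
      then show ?thesis using e vw n by auto
    next
      case b
      then obtain v w where "e = {v + L, w + L}" "1 \<le> v" "v < w" "w \<le> n - 2 * L" "X (v + L, w + L)"
        by (auto simp: B_def add.commute)
      then show ?thesis using n by force
    next
      case c
      then obtain f where f: "f \<in> A" "e = (+) (n - L) ` f" by auto
      then obtain v w where vw: "f = {v, w}" "1 \<le> v" "v < w" "w \<le> L"
        using A by (auto simp: step_edges_def)
      have e: "e = {n - L + v, n - L + w}" using f vw by simp
      have "X (n - L + v, n - L + w)"
        by (intro outer[THEN iffD2] disjI2) (rule c[unfolded e] | use vw(2-4) n in linarith)+
      moreover have "1 \<le> n - L + v" "n - L + v < n - L + w" "n - L + w \<le> n" using vw n by linarith+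
      ultimately show ?thesis unfolding e by blast
    qed
  qed
  then show "(n, ?E) = osum (osum (L, A) (n - 2 * L, B)) (L, A)"
    using n by (simp add: osum_def)
qed

definition pairs :: "nat \<Rightarrow> (nat \<times> nat) set" where
  "pairs n = {(v, w). 1 \<le> v \<and> v < w \<and> w \<le> n}"

lemma pairs_Sigma: "pairs n = (SIGMA v:{1..n}. {v<..n})"
  by (auto simp: pairs_def)

lemma finite_pairs [simp]: "finite (pairs n)"
  by (simp add: pairs_Sigma)

lemma pairs_swap: "pairs n = prod.swap ` (SIGMA w:{1..n}. {1..<w})"
  by (force simp: pairs_def)

lemma prod_if_ge_power:
  fixes P :: real
  assumes "finite I" "J \<subseteq> I" "0 \<le> P" "\<And>i. i \<in> J \<Longrightarrow> P \<le> f i"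
  shows "P ^ card J \<le> (\<Prod>i\<in>I. if i \<in> J then f i else 1)"
proof -
  have "P ^ card J = (\<Prod>i\<in>J. P)" by simp
  also have "\<dots> \<le> (\<Prod>i\<in>J. f i)" using assms by (intro prod_mono) auto
  also have "\<dots> = (\<Prod>i\<in>I. if i \<in> J then f i else 1)"
    using assms(1,2) by (simp add: prod.If_cases Int_absorb1)
  finally show ?thesis .
qed

text \<open>A fixed \<open>v\<close> contributes a partial product of \<open>q 1, q 2, \<dots>\<close>, whatever \<open>n\<close> is; this is where
  the bound becomes independent of \<open>n\<close>.\<close>

lemma prod_first_vertices_ge:
  fixes q :: "nat \<Rightarrow> real"
  assumes P: "0 \<le> P" "\<And>m. P \<le> (\<Prod>i<m. q (Suc i))" and L: "L \<le> n"
  shows "P ^ L \<le> (\<Prod>(v, w)\<in>pairs n. if v \<le> L then q (w - v) else 1)"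
proof -
  have row: "P \<le> (\<Prod>w\<in>{v<..n}. q (w - v))" for v
  proof -
    have "(\<Prod>w\<in>{v<..n}. q (w - v)) = (\<Prod>i<n - v. q (Suc i))"
      by (rule prod.reindex_bij_witness[of _ "\<lambda>i. v + Suc i" "\<lambda>w. w - Suc v"])
        (auto simp: Suc_diff_Suc)
    then show ?thesis using P(2) by simp
  qed
  have "P ^ card {1..L} \<le> (\<Prod>v\<in>{1..n}. if v \<in> {1..L} then \<Prod>w\<in>{v<..n}. q (w - v) else 1)"
    by (rule prod_if_ge_power) (use L P row in auto)
  also have "\<dots> = (\<Prod>v\<in>{1..n}. \<Prod>w\<in>{v<..n}. if v \<le> L then q (w - v) else 1)"
    by (intro prod.cong) auto
  also have "\<dots> = (\<Prod>(v, w)\<in>pairs n. if v \<le> L then q (w - v) else 1)"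
    unfolding pairs_Sigma by (rule prod.Sigma) auto
  finally show ?thesis by simp
qed

lemma prod_last_vertices_ge:
  fixes q :: "nat \<Rightarrow> real"
  assumes P: "0 \<le> P" "\<And>m. P \<le> (\<Prod>i<m. q (Suc i))" and L: "L \<le> n"
  shows "P ^ L \<le> (\<Prod>(v, w)\<in>pairs n. if n - L < w then q (w - v) else 1)"
proof -
  have col: "P \<le> (\<Prod>v\<in>{1..<w}. q (w - v))" for w
  proof -
    have "(\<Prod>v\<in>{1..<w}. q (w - v)) = (\<Prod>i<w - 1. q (Suc i))"
      by (rule prod.reindex_bij_witness[of _ "\<lambda>i. w - Suc i" "\<lambda>v. w - Suc v"])
        (auto simp: Suc_diff_Suc)
    then show ?thesis using P(2) by simp
  qed
  have "P ^ card {n - L<..n} \<le>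
      (\<Prod>w\<in>{1..n}. if w \<in> {n - L<..n} then \<Prod>v\<in>{1..<w}. q (w - v) else 1)"
    by (rule prod_if_ge_power) (use L P col in auto)
  also have "\<dots> = (\<Prod>w\<in>{1..n}. \<Prod>v\<in>{1..<w}. if n - L < w then q (w - v) else 1)"
    by (intro prod.cong) auto
  also have "\<dots> = (\<Prod>(w, v)\<in>(SIGMA w:{1..n}. {1..<w}). if n - L < w then q (w - v) else 1)"
    by (rule prod.Sigma) auto
  also have "\<dots> = (\<Prod>(v, w)\<in>pairs n. if n - L < w then q (w - v) else 1)"
    unfolding pairs_swap by (subst prod.reindex) (auto simp: case_prod_unfold intro!: prod.cong)
  finally show ?thesis using L by simp
qed

lemma mult4_le:
  fixes a b c d :: real
  assumes "0 \<le> a" "a \<le> 1" "0 \<le> b" "b \<le> 1" "0 \<le> c" "c \<le> 1" "0 \<le> d" "d \<le> 1"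
  shows "a * b * (c * d) \<le> a" "a * b * (c * d) \<le> b" "a * b * (c * d) \<le> c" "a * b * (c * d) \<le> d"
proof -
  have 1: "a * b \<le> a" "a * b \<le> b" "c * d \<le> c" "c * d \<le> d" "0 \<le> a * b" "0 \<le> c * d"
    using assms by (auto intro: mult_left_le mult_left_le_one_le)
  have 2: "a * b * (c * d) \<le> a * b" "a * b * (c * d) \<le> c * d"
    using 1 assms by (auto intro!: mult_left_le mult_left_le_one_le)
  show "a * b * (c * d) \<le> a" "a * b * (c * d) \<le> b" "a * b * (c * d) \<le> c" "a * b * (c * d) \<le> d"
    using 1 2 by linarith+
qed

text \<open>
  The event contains a product event, whose factor at a pair that meets the outer vertices is \<open>p\<close> or
  \<open>1 - p\<close> according to whether the pair has to be an edge. Each factor is bounded below by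
  a product of four numbers in \<open>[0, 1]\<close>, two that pretend the pair has to be a non-edge (\<open>f1\<close> for the
  first vertices, \<open>f2\<close> for the last ones) and two for the edges of the copies of \<open>(L, A)\<close>
  (\<open>g1\<close>, \<open>g2\<close>). Superfluous factors only decrease the bound, and make each of the four products
  over all pairs easy to evaluate.
\<close>

lemma prob_padded_ge:
  fixes p :: "nat \<Rightarrow> real" and A :: "nat set set"
  defines "D \<equiv> {d. 0 < p d}"
  assumes p01: "\<And>i. 1 \<le> i \<Longrightarrow> 0 \<le> p i \<and> p i \<le> 1"
    and P: "0 \<le> P" "\<And>m. P \<le> (\<Prod>i<m. 1 - p (Suc i))"
    and A: "A \<subseteq> step_edges D L" and n: "2 * L \<le> n"
  shows "P ^ L * P ^ L * (\<Prod>(v, w)\<in>pairs L. if {v, w} \<in> A then p (w - v) else 1)\<^sup>2 \<le>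
    measure_pmf.prob (random_graph n p)
      {E. \<exists>H\<in>carrier (graph_monoid D). (n, E) = osum (osum (L, A) H) (L, A)}"
proof -
  let ?k = "n - L"
  let ?A' = "(`) ((+) ?k) ` A"
  let ?\<alpha> = "\<Prod>(v, w)\<in>pairs L. if {v, w} \<in> A then p (w - v) else 1"
  let ?M = "Pi_pmf (pairs n) False (\<lambda>(v, w). bernoulli_pmf (p (w - v)))"
  let ?gr = "\<lambda>X. {{v, w} |v w. 1 \<le> v \<and> v < w \<and> w \<le> n \<and> X (v, w)}"
  \<comment> \<open>Edges of probability \<open>0\<close> have to be excluded in the middle part as well, at no cost, because
    the middle part must belong to the monoid.\<close>
  define B where "B = (\<lambda>(v, w). if v \<le> L \<or> ?k < w then {{v, w} \<in> A \<or> {v, w} \<in> ?A'}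
    else {b. b \<longrightarrow> w - v \<in> D})"
  let ?f1 = "\<lambda>(v, w). if v \<le> L then 1 - p (w - v) else 1"
  let ?f2 = "\<lambda>(v, w). if ?k < w then 1 - p (w - v) else 1"
  let ?g1 = "\<lambda>(v, w). if {v, w} \<in> A then p (w - v) else 1"
  let ?g2 = "\<lambda>(v, w). if {v, w} \<in> ?A' then p (w - v) else 1"
  have A_pairs: "(v, w) \<in> pairs L \<and> w - v \<in> D" if "{v, w} \<in> A" "v < w" for v w
    using step_edgesD[OF subsetD[OF A that(1)] that(2)] that(2) by (simp add: pairs_def)
  have A'_pairs: "\<exists>(v', w')\<in>pairs L. {v', w'} \<in> A \<and> v = ?k + v' \<and> w = ?k + w'"
    if "{v, w} \<in> ?A'" "v < w" for v w
  proof -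
    obtain f where f: "f \<in> A" "{v, w} = (+) ?k ` f" using \<open>{v, w} \<in> ?A'\<close> by auto
    then obtain v' w' where f': "f = {v', w'}" "1 \<le> v'" "v' < w'" "w' \<le> L"
      using A by (auto simp: step_edges_def)
    have "v = ?k + v'" "w = ?k + w'" using f f' \<open>v < w\<close> by (auto simp: doubleton_eq_iff)
    moreover have "(v', w') \<in> pairs L" "{v', w'} \<in> A" using f f' by (simp_all add: pairs_def)
    ultimately show ?thesis by blast
  qed
  have factor: "?f1 (v, w) * ?f2 (v, w) * (?g1 (v, w) * ?g2 (v, w)) \<le>
      measure_pmf.prob (bernoulli_pmf (p (w - v))) (B (v, w))" if vw: "(v, w) \<in> pairs n" for v w
  proof -
    have q: "0 \<le> p (w - v)" "p (w - v) \<le> 1"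
      using p01[of "w - v"] vw by (auto simp: pairs_def)
    define y where "y = ?f1 (v, w) * ?f2 (v, w) * (?g1 (v, w) * ?g2 (v, w))"
    have le: "y \<le> ?f1 (v, w)"
      "y \<le> ?f2 (v, w)"
      "y \<le> ?g1 (v, w)"
      "y \<le> ?g2 (v, w)"
      unfolding y_def by (rule mult4_le; use q in simp)+
    have single: "measure_pmf.prob (bernoulli_pmf (p (w - v))) {b} = (if b then p (w - v) else 1 - p (w - v))" for b
      using q by (cases b) (auto simp: measure_pmf_single)
    have "y \<le> measure_pmf.prob (bernoulli_pmf (p (w - v))) (B (v, w))"
    proof (cases "v \<le> L \<or> ?k < w")
      case True
      show ?thesis
      proof (cases "{v, w} \<in> A \<or> {v, w} \<in> ?A'")
        case edge: True
        then have "B (v, w) = {True}" using True by (auto simp: B_def)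
        then show ?thesis using le(3,4) single[of True] edge by (auto split: if_splits)
      next
        case no_edge: False
        then have "B (v, w) = {False}" using True by (auto simp: B_def)
        then show ?thesis using le(1,2) single[of False] True by (auto split: if_splits)
      qed
    next
      case False
      have "measure_pmf.prob (bernoulli_pmf (p (w - v))) (B (v, w)) = 1"
      proof (cases "w - v \<in> D")
        case True
        then have "B (v, w) = UNIV" using False by (auto simp: B_def)
        then show ?thesis by simp
      next
        case no: False
        then have "B (v, w) = {False}" using False by (auto simp: B_def)
        then show ?thesis using no q single[of False] by (auto simp: D_def)
      qed
      then show ?thesis using le(1) q False by (auto split: if_splits)
    qed
    then show ?thesis unfolding y_def .
  qed
  have g1: "(\<Prod>z\<in>pairs n. ?g1 z) = ?\<alpha>"
  proof (rule prod.mono_neutral_right[OF finite_pairs])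
    show "pairs L \<subseteq> pairs n" using n by (auto simp: pairs_def)
    show "\<forall>z\<in>pairs n - pairs L. ?g1 z = 1"
    proof clarify
      fix v w assume vw: "(v, w) \<in> pairs n" "(v, w) \<notin> pairs L"
      then have "v < w" by (simp add: pairs_def)
      then have "{v, w} \<notin> A" using A_pairs vw(2) by blast
      then show "(if {v, w} \<in> A then p (w - v) else 1) = 1" by simp
    qed
  qed
  have g2: "(\<Prod>z\<in>pairs n. ?g2 z) = ?\<alpha>"
  proof -
    let ?h = "\<lambda>(v, w). (?k + v, ?k + w)"
    have "(\<Prod>z\<in>pairs n. ?g2 z) = (\<Prod>z\<in>?h ` pairs L. ?g2 z)"
    proof (rule prod.mono_neutral_right[OF finite_pairs])
      show "?h ` pairs L \<subseteq> pairs n" using n by (auto simp: pairs_def)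
      show "\<forall>z\<in>pairs n - ?h ` pairs L. ?g2 z = 1"
      proof clarify
        fix v w assume vw: "(v, w) \<in> pairs n" "(v, w) \<notin> ?h ` pairs L"
        then have "v < w" by (simp add: pairs_def)
        have "{v, w} \<notin> ?A'"
        proof
          assume "{v, w} \<in> ?A'"
          from A'_pairs[OF this \<open>v < w\<close>] show False using vw(2) by (auto simp: image_iff)
        qed
        then show "(if {v, w} \<in> ?A' then p (w - v) else 1) = 1" by simp
      qed
    qed
    also have "\<dots> = (\<Prod>z\<in>pairs L. ?g2 (?h z))"
      by (subst prod.reindex) (auto simp: inj_on_def)
    also have "\<dots> = ?\<alpha>"
    proof (rule prod.cong, goal_cases)
      case (2 z)
      obtain v w where z: "z = (v, w)" by (cases z)
      have "{?k + v, ?k + w} = (+) ?k ` {v, w}" by simp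
      then have "{?k + v, ?k + w} \<in> ?A' \<longleftrightarrow> {v, w} \<in> A"
        by (metis (no_types, lifting) image_iff inj_image_eq_iff inj_on_add)
      then show ?case by (simp add: z)
    qed simp
    finally show ?thesis .
  qed
  have "0 \<le> (\<Prod>z\<in>pairs n. ?f1 z)" "0 \<le> (\<Prod>z\<in>pairs n. ?f2 z)" and \<alpha>: "0 \<le> ?\<alpha>"
    using p01 by (auto simp: pairs_def intro!: prod_nonneg)
  then have "P ^ L * P ^ L * ?\<alpha>\<^sup>2 \<le> (\<Prod>z\<in>pairs n. ?f1 z) * (\<Prod>z\<in>pairs n. ?f2 z) * (?\<alpha> * ?\<alpha>)"
    using prod_first_vertices_ge[of P "\<lambda>d. 1 - p d", OF P, of L n]
      prod_last_vertices_ge[of P "\<lambda>d. 1 - p d", OF P, of L n] n P(1)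
    unfolding power2_eq_square by (intro mult_mono) auto
  also have "\<dots> = (\<Prod>z\<in>pairs n. ?f1 z * ?f2 z * (?g1 z * ?g2 z))"
    unfolding prod.distrib g1 g2 ..
  also have "\<dots> \<le> (\<Prod>z\<in>pairs n. measure_pmf.prob (case z of (v, w) \<Rightarrow> bernoulli_pmf (p (w - v))) (B z))"
  proof (rule prod_mono)
    fix z assume "z \<in> pairs n"
    then obtain v w where z: "z = (v, w)" and vw: "(v, w) \<in> pairs n" by (cases z) auto
    have "0 \<le> p (w - v)" "p (w - v) \<le> 1"
      using p01[of "w - v"] vw by (auto simp: pairs_def)
    then show "0 \<le> ?f1 z * ?f2 z * (?g1 z * ?g2 z) \<and> ?f1 z * ?f2 z * (?g1 z * ?g2 z) \<le>
        measure_pmf.prob (case z of (v, w) \<Rightarrow> bernoulli_pmf (p (w - v))) (B z)"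
      using factor[OF vw] unfolding z by simp
  qed
  also have "\<dots> = measure_pmf.prob ?M (Pi (pairs n) B)"
    by (rule measure_Pi_pmf_Pi[symmetric]) simp
  also have "\<dots> \<le> measure_pmf.prob ?M
      (?gr -` {E. \<exists>H\<in>carrier (graph_monoid D). (n, E) = osum (osum (L, A) H) (L, A)})"
  proof (rule measure_pmf.finite_measure_mono, rule subsetI, rule vimageI2, rule CollectI)
    fix X assume X: "X \<in> Pi (pairs n) B"
    have XB: "X (v, w) \<in> B (v, w)" if "1 \<le> v" "v < w" "w \<le> n" for v w
      using X that by (auto simp: pairs_def)
    show "\<exists>H\<in>carrier (graph_monoid D). (n, ?gr X) = osum (osum (L, A) H) (L, A)"
    proof (rule padded_decomposition[OF A n])
      show outer: "X (v, w) \<longleftrightarrow> {v, w} \<in> A \<or> {v, w} \<in> ?A'"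
        if "1 \<le> v" "v < w" "w \<le> n" "v \<le> L \<or> ?k < w" for v w
        using XB[OF that(1-3)] that(4) by (simp add: B_def)
      show "w - v \<in> D" if vw: "1 \<le> v" "v < w" "w \<le> n" "X (v, w)" for v w
      proof (cases "v \<le> L \<or> ?k < w")
        case True
        then consider "{v, w} \<in> A" | "{v, w} \<in> ?A'" using outer vw by blast
        then show ?thesis
        proof cases
          case 1
          then show ?thesis using A_pairs vw by blast
        next
          case 2
          then obtain v' w' where "(v', w') \<in> pairs L" "{v', w'} \<in> A" "v = ?k + v'" "w = ?k + w'"
            using A'_pairs[OF 2 vw(2)] by blast
          then show ?thesis using A_pairs[of v' w'] vw by auto
        qed
      next
        case False
        then show ?thesis using XB[OF vw(1-3)] vw(4) by (simp add: B_def)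
      qed
    qed
  qed simp
  finally show ?thesis
    by (simp add: random_graph_def pairs_def)
qed

text \<open>Since \<open>P \<noteq> 0\<close>, the infinite product is the limit of the partial products from index \<open>0\<close> on, and
  these decrease.\<close>

lemma has_prod_le_partial_prod:
  fixes p :: "nat \<Rightarrow> real"
  assumes "\<And>i. 1 \<le> i \<Longrightarrow> 0 \<le> p i \<and> p i \<le> 1"
    and "(\<lambda>i. 1 - p (Suc i)) has_prod P" and "P > 0"
  shows "P \<le> (\<Prod>i<m. 1 - p (Suc i))"
proof -
  let ?S = "\<lambda>n. \<Prod>i\<le>n. 1 - p (Suc i)"
  have "?S \<longlonglongrightarrow> P"
    using assms(2,3) by (auto simp: has_prod_def raw_has_prod_def)
  moreover have le: "(\<Prod>i\<in>B. 1 - p (Suc i)) \<le> (\<Prod>i\<in>A. 1 - p (Suc i))"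
    if "A \<subseteq> B" "finite B" for A B
  proof -
    have "(\<Prod>i\<in>B. 1 - p (Suc i)) = (\<Prod>i\<in>A. 1 - p (Suc i)) * (\<Prod>i\<in>B - A. 1 - p (Suc i))"
      using that by (metis mult.commute prod.subset_diff)
    also have "\<dots> \<le> (\<Prod>i\<in>A. 1 - p (Suc i))"
      using assms(1) by (intro mult_left_le prod_le_1 prod_nonneg) auto
    finally show ?thesis .
  qed
  have "decseq ?S" by (rule decseq_SucI, rule le) auto
  ultimately have "P \<le> ?S m" using decseq_ge by blast
  also have "\<dots> \<le> (\<Prod>i<m. 1 - p (Suc i))" by (rule le) auto
  finally show ?thesis .
qed

section \<open>The theorem\<close>

theorem mainTheorem6:
  fixes p :: "nat \<Rightarrow> real" and P :: real and \<psi> :: fo_fm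
  assumes "\<And>i. 1 \<le> i \<Longrightarrow> 0 \<le> p i \<and> p i \<le> 1"
    and "(\<lambda>i. 1 - p (Suc i)) has_prod P" and "P > 0"
    and "sentence \<psi>"
  shows "limsup (\<lambda>n. ereal (Prob n p \<psi>)) - liminf (\<lambda>n. ereal (Prob n p \<psi>)) < 1"
proof -
  define D where "D = {d. 0 < p d}"
  define K where "K = var_bound \<psi>"
  define k where "k = qdepth \<psi>"
  obtain L A where U: "(L, A) \<in> carrier (graph_monoid D)"
    and absorb: "\<And>X. X \<in> carrier (graph_monoid D) \<Longrightarrow>
      ef_type K k (osum (osum (L, A) X) (L, A)) (\<lambda>_. 0) = ef_type K k (L, A) (\<lambda>_. 0)"
    using exists_absorbing_graph[of D K k] by fast
  have A: "A \<subseteq> step_edges D L" using U by (simp add: graph_monoid_def)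
  define c where "c = P ^ L * P ^ L * (\<Prod>(v, w)\<in>pairs L. if {v, w} \<in> A then p (w - v) else 1)\<^sup>2"
  have "0 < (\<Prod>(v, w)\<in>pairs L. if {v, w} \<in> A then p (w - v) else 1)"
    by (intro prod_pos) (auto simp: pairs_def D_def dest!: subsetD[OF A] step_edgesD)
  then have c: "c > 0" using assms(3) unfolding c_def by (intro mult_pos_pos zero_less_power)
  define good where "good n = {E. \<exists>H\<in>carrier (graph_monoid D). (n, E) = osum (osum (L, A) H) (L, A)}" for n
  have good_prob: "c \<le> measure_pmf.prob (random_graph n p) (good n)" if "2 * L \<le> n" for n
    unfolding c_def good_def D_def
    by (rule prob_padded_ge[OF assms(1)])
      (use assms has_prod_le_partial_prod[OF assms(1-3)] A that in \<open>auto simp: D_def\<close>)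
  have good_iff: "holds_in n E \<psi> \<longleftrightarrow> sat L A (\<lambda>_. 0) \<psi>" if "E \<in> good n" "n \<ge> 1" for n E
  proof -
    obtain H where "H \<in> carrier (graph_monoid D)" "(n, E) = osum (osum (L, A) H) (L, A)"
      using \<open>E \<in> good n\<close> by (auto simp: good_def)
    then have "ef_type K k (n, E) (\<lambda>_. 0) = ef_type K k (L, A) (\<lambda>_. 0)" using absorb by simp
    then show ?thesis
      using sat_eq_if_ef_type_eq[of K k "(n, E)" "\<lambda>_. 0" "(L, A)" "\<lambda>_. 0" \<psi>]
        holds_in_sentence_iff[OF assms(4) \<open>n \<ge> 1\<close>, of E] by (simp add: K_def k_def)
  qed
  have le1: "limsup (\<lambda>n. ereal (Prob n p \<psi>)) \<le> 1"
    by (rule Limsup_bounded) (simp add: Prob_def)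
  have ge0: "0 \<le> liminf (\<lambda>n. ereal (Prob n p \<psi>))"
    by (rule Liminf_bounded) (simp add: Prob_def)
  have le: "liminf (\<lambda>n. ereal (Prob n p \<psi>)) \<le> limsup (\<lambda>n. ereal (Prob n p \<psi>))"
    by (rule Liminf_le_Limsup) simp
  \<comment> \<open>The summand \<open>1\<close> excludes \<open>n = 0\<close>, where every sentence holds for lack of an assignment.\<close>
  have ev: "\<forall>\<^sub>F n in sequentially. n \<ge> 2 * L + 1" by (rule eventually_ge_at_top)
  consider "sat L A (\<lambda>_. 0) \<psi>" | "\<not> sat L A (\<lambda>_. 0) \<psi>" by blast
  then show ?thesis
  proof cases
    case 1
    have "c \<le> Prob n p \<psi>" if n: "n \<ge> 2 * L + 1" for n
    proof -
      have "c \<le> measure_pmf.prob (random_graph n p) (good n)" using good_prob n by simp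
      also have "\<dots> \<le> Prob n p \<psi>"
        unfolding Prob_def by (rule measure_pmf.finite_measure_mono) (use good_iff 1 n in auto)
      finally show ?thesis .
    qed
    then have "ereal c \<le> liminf (\<lambda>n. ereal (Prob n p \<psi>))"
      by (intro Liminf_bounded eventually_mono[OF ev]) simp
    then show ?thesis using le1 le c
      by (cases "liminf (\<lambda>n. ereal (Prob n p \<psi>))"; cases "limsup (\<lambda>n. ereal (Prob n p \<psi>))")
        (auto simp: one_ereal_def)
  next
    case 2
    have "Prob n p \<psi> \<le> 1 - c" if n: "n \<ge> 2 * L + 1" for n
    proof -
      have "Prob n p \<psi> \<le> measure_pmf.prob (random_graph n p) (UNIV - good n)"
        unfolding Prob_def by (rule measure_pmf.finite_measure_mono) (use good_iff 2 n in auto)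
      also have "\<dots> = 1 - measure_pmf.prob (random_graph n p) (good n)"
        using measure_pmf.prob_compl[of "good n" "random_graph n p"] by simp
      also have "\<dots> \<le> 1 - c" using good_prob[of n] n by simp
      finally show ?thesis .
    qed
    then have "limsup (\<lambda>n. ereal (Prob n p \<psi>)) \<le> ereal (1 - c)"
      by (intro Limsup_bounded eventually_mono[OF ev]) simp
    then show ?thesis using ge0 le c
      by (cases "liminf (\<lambda>n. ereal (Prob n p \<psi>))"; cases "limsup (\<lambda>n. ereal (Prob n p \<psi>))")
        (auto simp: one_ereal_def)
  qed
qed

end
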